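(* Let $\epsilon>0$, $n\ge 1$, $N\in\{2n,2n+1\}$, and let $p_0$ satisfy $0\le p_0\le p$ (with $p_0=0$ if $N=2n$). Then the structured $N$-output mechanism with parameters $(\epsilon,N,p_0)$ and any admissible output set $\Omega$ is $\epsilon$-LDP: for every output index $i$ and all $x,x'\in[-1,1]$, $$p_i(x)\le e^{\epsilon}\,p_i(x').$$
   Context: Structured $N$-output mechanism. Let $\epsilon>0$, $n\ge1$, $N=2n$ or $N=2n+1$. Let $p_0$ be a parameter and set $$p=\frac{1-p_0}{e^\epsilon+2n-1},\qquad p^*=\frac{1-2(n-1)p-e^\epsilon p_0}{2},\qquad t=(e^\epsilon-1)p .$$ It is required that $0\le p_0\le p$; if $N=2n$ then $p_0=0$ (the output $a_0$ is not used and has probability $0$). An admissible output set $\Omega$ is given by reals $a_{-n}<a_{-n+1}<\dots<a_n$ with $a_{-i}=-a_i$, $a_0=0$ and $a_n=1/t$; $\Omega=\{a_i\}_{i=-n}^n$ if $N=2n+1$ and $\Omega=\{a_i\}_{i=-n}^n\setminus\{a_0\}$ if $N=2n$. For $i,j\in\{-n,\dots,n\}$ define $P_{i,j}$ by: for $i=0$: $P_{0,0}=e^\epsilon p_0$ and $P_{0,j}=p_0$ for $j\ne0$; for $|i|>1$: $P_{i,i}=e^\epsilon p$ and $P_{i,j}=p$ for $j\neq i$; for $|i|=1$: $P_{i,i}=e^\epsilon p$, $P_{i,0}=p^*$, and $P_{i,j}=p$ for all other $j$. Put $x_j=\sum_{i=-n}^n a_iP_{i,j}$, which equals $ta_j$;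 thus $-1=x_{-n}<\dots<x_n=1$. On input $x\in[-1,1]$ the mechanism outputs $a_i$ with probability $p_i(x)$, where $p_i:[-1,1]\to\mathbb{R}$ is the continuous function that is affine on each $[x_{j-1},x_j]$ ($j=-n+1,\dots,n$) with $p_i(x_j)=P_{i,j}$. *)

theory Defs
  imports Complex_Main
begin

text \<open>Index sets are sets of integers. For \<open>N = 2 n\<close> the index \<open>0\<close> is not an output.\<close>

definition indices :: "nat \<Rightarrow> int set" where
  "indices n = {- int n..int n}"

definition output_indices :: "nat \<Rightarrow> nat \<Rightarrow> int set" where
  "output_indices n N = (if N = 2 * n then indices n - {0} else indices n)"

text \<open>The quantities written \<open>p\<close>, \<open>p\<^sup>*\<close> and \<open>t\<close>.\<close>

definition p_base :: "real \<Rightarrow> nat \<Rightarrow> real \<Rightarrow> real" where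
  "p_base \<epsilon> n p0 = (1 - p0) / (exp \<epsilon> + 2 * real n - 1)"

definition p_star :: "real \<Rightarrow> nat \<Rightarrow> real \<Rightarrow> real" where
  "p_star \<epsilon> n p0 = (1 - 2 * (real n - 1) * p_base \<epsilon> n p0 - exp \<epsilon> * p0) / 2"

definition t_scale :: "real \<Rightarrow> nat \<Rightarrow> real \<Rightarrow> real" where
  "t_scale \<epsilon> n p0 = (exp \<epsilon> - 1) * p_base \<epsilon> n p0"

definition valid_params :: "real \<Rightarrow> nat \<Rightarrow> nat \<Rightarrow> real \<Rightarrow> bool" where
  "valid_params \<epsilon> n N p0 \<longleftrightarrow>
     \<epsilon> > 0 \<and> n \<ge> 1 \<and> (N = 2 * n \<or> N = 2 * n + 1) \<and>
     0 \<le> p0 \<and> p0 \<le> p_base \<epsilon> n p0 \<and> (N = 2 * n \<longrightarrow> p0 = 0)"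

text \<open>An output set is given by its enumeration \<open>a\<close>, whose values outside
  \<open>indices n\<close> are irrelevant; the set itself is \<open>a ` output_indices n N\<close>.\<close>

definition admissible_outputs :: "real \<Rightarrow> nat \<Rightarrow> real \<Rightarrow> (int \<Rightarrow> real) \<Rightarrow> bool" where
  "admissible_outputs \<epsilon> n p0 a \<longleftrightarrow>
     strict_mono_on (indices n) a \<and> (\<forall>i\<in>indices n. a (- i) = - a i) \<and>
     a 0 = 0 \<and> a (int n) = 1 / t_scale \<epsilon> n p0"

definition P :: "real \<Rightarrow> nat \<Rightarrow> real \<Rightarrow> int \<Rightarrow> int \<Rightarrow> real" where
  "P \<epsilon> n p0 i j =
     (if i = 0 then (if j = 0 then exp \<epsilon> * p0 else p0)
      else if \<bar>i\<bar> > 1 then (if j = i then exp \<epsilon> * p_base \<epsilon> n p0 else p_base \<epsilon> n p0)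
      else (if j = i then exp \<epsilon> * p_base \<epsilon> n p0
            else if j = 0 then p_star \<epsilon> n p0 else p_base \<epsilon> n p0))"

definition node :: "real \<Rightarrow> nat \<Rightarrow> real \<Rightarrow> (int \<Rightarrow> real) \<Rightarrow> int \<Rightarrow> real" where
  "node \<epsilon> n p0 a j = (\<Sum>i\<in>indices n. a i * P \<epsilon> n p0 i j)"

definition affine_on :: "real set \<Rightarrow> (real \<Rightarrow> real) \<Rightarrow> bool" where
  "affine_on S f \<longleftrightarrow> (\<exists>c d. \<forall>x\<in>S. f x = c * x + d)"

text \<open>\<open>q i x\<close> is the probability of the output \<open>a i\<close> on input \<open>x\<close>. The conditions
  determine \<open>q i\<close> uniquely on \<open>{-1..1}\<close> and leave it arbitrary elsewhere; existence
  is lemma \<open>structured_mechanism_exists\<close>.\<close>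

definition structured_mechanism ::
  "real \<Rightarrow> nat \<Rightarrow> real \<Rightarrow> (int \<Rightarrow> real) \<Rightarrow> (int \<Rightarrow> real \<Rightarrow> real) \<Rightarrow> bool" where
  "structured_mechanism \<epsilon> n p0 a q \<longleftrightarrow>
     (\<forall>i\<in>indices n.
        continuous_on {-1..1} (q i) \<and>
        (\<forall>j\<in>{- int n + 1..int n}. affine_on {node \<epsilon> n p0 a (j - 1)..node \<epsilon> n p0 a j} (q i)) \<and>
        (\<forall>j\<in>indices n. q i (node \<epsilon> n p0 a j) = P \<epsilon> n p0 i j))"

definition locally_dp :: "real \<Rightarrow> int set \<Rightarrow> (int \<Rightarrow> real \<Rightarrow> real) \<Rightarrow> bool" where
  "locally_dp \<epsilon> I q \<longleftrightarrow>
     (\<forall>i\<in>I. \<forall>x\<in>{-1..1}. \<forall>x'\<in>{-1..1}. q i x \<le> exp \<epsilon> * q i x')"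

lemma p_base_pos:
  assumes "valid_params \<epsilon> n N p0"
  shows "p_base \<epsilon> n p0 > 0"
proof -
  have D: "exp \<epsilon> + 2 * real n - 1 > 0"
    using assms exp_gt_zero[of \<epsilon>] unfolding valid_params_def by linarith
  have "p_base \<epsilon> n p0 \<ge> 0" using assms unfolding valid_params_def by linarith
  moreover have "p_base \<epsilon> n p0 \<noteq> 0"
  proof
    assume *: "p_base \<epsilon> n p0 = 0"
    then have "p0 = 0" using assms unfolding valid_params_def by linarith
    then show False using * D unfolding p_base_def by auto
  qed
  ultimately show ?thesis by linarith
qed

lemma t_scale_pos:
  assumes "valid_params \<epsilon> n N p0"
  shows "t_scale \<epsilon> n p0 > 0"
  using p_base_pos[OF assms] assms unfolding t_scale_def valid_params_def by simp

lemma sum_odd: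
  fixes f :: "int \<Rightarrow> real"
  assumes "\<And>i. i \<in> indices n \<Longrightarrow> f (- i) = - f i"
  shows "(\<Sum>i\<in>indices n. f i) = 0"
proof -
  have "(\<Sum>i\<in>indices n. f i) = (\<Sum>i\<in>indices n. f (- i))"
    by (rule sum.reindex_bij_witness[of _ uminus uminus]) (auto simp: indices_def)
  also have "\<dots> = - (\<Sum>i\<in>indices n. f i)"
    using assms by (simp add: sum_negf)
  finally show ?thesis by linarith
qed

lemma sum_P_column:
  assumes v: "valid_params \<epsilon> n N p0" and j: "j \<in> indices n"
  shows "(\<Sum>i\<in>indices n. P \<epsilon> n p0 i j) = 1"
proof -
  let ?p = "p_base \<epsilon> n p0"
  have n: "n \<ge> 1" using v by (simp add: valid_params_def)
  have D: "exp \<epsilon> + 2 * real n - 1 > 0"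
    using n exp_gt_zero[of \<epsilon>] by linarith
  have total: "(exp \<epsilon> + 2 * real n - 1) * ?p = 1 - p0"
    using D by (simp add: p_base_def)
  have fin: "finite (indices n)" and z: "0 \<in> indices n" "1 \<in> indices n" "-1 \<in> indices n"
    using n by (auto simp: indices_def)
  have card: "real (card (indices n)) = 2 * real n + 1"
    by (simp add: indices_def)
  show ?thesis
  proof (cases "j = 0")
    case True
    have "(\<Sum>i\<in>indices n. P \<epsilon> n p0 i j) =
        (\<Sum>i\<in>indices n. ?p + (if i = 0 then exp \<epsilon> * p0 - ?p else 0)
           + (if i = 1 then p_star \<epsilon> n p0 - ?p else 0) + (if i = -1 then p_star \<epsilon> n p0 - ?p else 0))"
      by (rule sum.cong) (auto simp: P_def True)
    also have "\<dots> = (2 * real n + 1) * ?p + (exp \<epsilon> * p0 - ?p) + 2 * (p_star \<epsilon> n p0 - ?p)"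
      using fin z by (simp add: sum.distrib card)
    also have "\<dots> = 1" by (simp add: p_star_def field_simps)
    finally show ?thesis .
  next
    case False
    have "(\<Sum>i\<in>indices n. P \<epsilon> n p0 i j) =
        (\<Sum>i\<in>indices n. ?p + (if i = 0 then p0 - ?p else 0) + (if i = j then (exp \<epsilon> - 1) * ?p else 0))"
      by (rule sum.cong) (use False in \<open>auto simp: P_def algebra_simps\<close>)
    also have "\<dots> = (2 * real n + 1) * ?p + (p0 - ?p) + (exp \<epsilon> - 1) * ?p"
      using fin z j by (simp add: sum.distrib card)
    also have "\<dots> = 1" using total by (simp add: algebra_simps)
    finally show ?thesis .
  qed
qed

lemma node_eq:
  assumes a: "admissible_outputs \<epsilon> n p0 a" and j: "j \<in> indices n"
  shows "node \<epsilon> n p0 a j = t_scale \<epsilon> n p0 * a j"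
proof (cases "j = 0")
  case True
  have "node \<epsilon> n p0 a j = 0"
    unfolding node_def
    by (rule sum_odd) (use a True in \<open>auto simp: admissible_outputs_def P_def\<close>)
  then show ?thesis using True a by (simp add: admissible_outputs_def)
next
  case False
  let ?p = "p_base \<epsilon> n p0"
  have fin: "finite (indices n)" by (simp add: indices_def)
  have "node \<epsilon> n p0 a j =
      (\<Sum>i\<in>indices n. a i * ?p + (if i = j then t_scale \<epsilon> n p0 * a j else 0))"
    unfolding node_def
    by (rule sum.cong)
      (use False a in \<open>auto simp: P_def t_scale_def admissible_outputs_def algebra_simps\<close>)
  also have "\<dots> = (\<Sum>i\<in>indices n. a i) * ?p + t_scale \<epsilon> n p0 * a j"
    using j fin by (simp add: sum.distrib sum_distrib_right)
  also have "(\<Sum>i\<in>indices n. a i) = 0"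
    by (rule sum_odd) (use a in \<open>auto simp: admissible_outputs_def\<close>)
  finally show ?thesis by simp
qed

lemma node_less:
  assumes "valid_params \<epsilon> n N p0" "admissible_outputs \<epsilon> n p0 a"
    and "i \<in> indices n" "j \<in> indices n" "i < j"
  shows "node \<epsilon> n p0 a i < node \<epsilon> n p0 a j"
  using assms t_scale_pos[OF assms(1)]
  by (auto simp: node_eq admissible_outputs_def dest: strict_mono_onD)

lemma node_ends:
  assumes "valid_params \<epsilon> n N p0" "admissible_outputs \<epsilon> n p0 a"
  shows "node \<epsilon> n p0 a (int n) = 1" "node \<epsilon> n p0 a (- int n) = -1"
proof -
  have "int n \<in> indices n" "- int n \<in> indices n" by (auto simp: indices_def)
  moreover from this have "a (- int n) = - a (int n)"
    using assms(2) unfolding admissible_outputs_def by blast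
  ultimately show "node \<epsilon> n p0 a (int n) = 1" "node \<epsilon> n p0 a (- int n) = -1"
    using assms t_scale_pos[OF assms(1)] by (auto simp: node_eq admissible_outputs_def)
qed

lemma interpolation_exists:
  fixes X Y :: "int \<Rightarrow> real"
  assumes X: "\<And>i j. l \<le> i \<Longrightarrow> i < j \<Longrightarrow> j \<le> u \<Longrightarrow> X i < X j"
  shows "\<exists>f. continuous_on UNIV f \<and> (\<forall>j\<in>{l + 1..u}. affine_on {X (j - 1)..X j} f) \<and>
           (\<forall>j\<in>{l..u}. f (X j) = Y j)"
proof -
  have X': "X i \<le> X j" if "l \<le> i" "i \<le> j" "j \<le> u" for i j
    using X[of i j] that by (cases "i = j") auto
  define h where "h k x = (Y k - Y (k - 1)) * max 0 (min 1 ((x - X (k - 1)) / (X k - X (k - 1))))" for k x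
  define f where "f x = Y l + (\<Sum>k\<in>{l + 1..u}. h k x)" for x
  have lo: "h k x = 0" if "k \<in> {l + 1..u}" "x \<le> X (k - 1)" for k x
    using X[of "k - 1" k] that by (auto simp: h_def max_def min_def divide_simps)
  have hi: "h k x = Y k - Y (k - 1)" if "k \<in> {l + 1..u}" "X k \<le> x" for k x
    using X[of "k - 1" k] that by (auto simp: h_def max_def min_def divide_simps)
  have mid: "h k x = (Y k - Y (k - 1)) * ((x - X (k - 1)) / (X k - X (k - 1)))"
    if "k \<in> {l + 1..u}" "x \<in> {X (k - 1)..X k}" for k x
    using X[of "k - 1" k] that by (auto simp: h_def max_def min_def divide_simps)
  have "continuous_on UNIV f"
  proof -
    have "continuous_on UNIV (h k)" if "k \<in> {l + 1..u}" for k
      unfolding h_def using X[of "k - 1" k] that by (intro continuous_intros) auto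
    then show ?thesis unfolding f_def by (intro continuous_intros) auto
  qed
  moreover have "affine_on {X (j - 1)..X j} f" if j: "j \<in> {l + 1..u}" for j
  proof -
    have "\<exists>c d. \<forall>x\<in>{X (j - 1)..X j}. h k x = c * x + d" if k: "k \<in> {l + 1..u}" for k
    proof (cases k j rule: linorder_cases)
      case less
      then have "\<forall>x\<in>{X (j - 1)..X j}. h k x = 0 * x + (Y k - Y (k - 1))"
        using k j X'[of k "j - 1"] hi[OF k] by force
      then show ?thesis by blast
    next
      case greater
      then have "\<forall>x\<in>{X (j - 1)..X j}. h k x = 0 * x + 0"
        using k j X'[of j "k - 1"] lo[OF k] by force
      then show ?thesis by blast
    next
      case equal
      let ?c = "(Y k - Y (k - 1)) / (X k - X (k - 1))"
      have "\<forall>x\<in>{X (j - 1)..X j}. h k x = ?c * x + (- ?c * X (k - 1))"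
      proof
        fix x assume "x \<in> {X (j - 1)..X j}"
        then have "h k x = ?c * (x - X (k - 1))" using mid[OF k] equal by simp
        then show "h k x = ?c * x + (- ?c * X (k - 1))" by (simp only: algebra_simps)
      qed
      then show ?thesis by blast
    qed
    then obtain c d where cd: "\<And>k x. k \<in> {l + 1..u} \<Longrightarrow> x \<in> {X (j - 1)..X j} \<Longrightarrow> h k x = c k * x + d k"
      by metis
    have "\<forall>x\<in>{X (j - 1)..X j}. f x = (\<Sum>k\<in>{l + 1..u}. c k) * x + (Y l + (\<Sum>k\<in>{l + 1..u}. d k))"
      by (simp add: f_def cd sum.distrib sum_distrib_right)
    then show ?thesis unfolding affine_on_def by blast
  qed
  moreover have "f (X j) = Y j" if j: "j \<in> {l..u}" for j
  proof -
    have split: "{l + 1..u} = {l + 1..j} \<union> {j + 1..u}" "{l + 1..j} \<inter> {j + 1..u} = {}"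
      using j by auto
    have "(\<Sum>k\<in>{l + 1..u}. h k (X j)) = (\<Sum>k\<in>{l + 1..j}. h k (X j)) + (\<Sum>k\<in>{j + 1..u}. h k (X j))"
      unfolding split(1) by (rule sum.union_disjoint) (use split(2) in auto)
    also have "(\<Sum>k\<in>{j + 1..u}. h k (X j)) = 0"
      by (rule sum.neutral) (use j X' lo in auto)
    also have "(\<Sum>k\<in>{l + 1..j}. h k (X j)) = (\<Sum>k\<in>{l + 1..j}. Y k - Y (k - 1))"
      by (rule sum.cong) (use j X' hi in auto)
    also have "\<dots> = Y j - Y l"
    proof -
      have "l \<le> j" using j by simp
      then show ?thesis
      proof (induction j rule: int_ge_induct)
        case base then show ?case by simp
      next
        case (step i)
        have "{l + 1..i + 1} = insert (i + 1) {l + 1..i}" using step.hyps by auto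
        then show ?case using step.IH by simp
      qed
    qed
    finally show ?thesis by (simp add: f_def)
  qed
  ultimately show ?thesis by blast
qed

lemma structured_mechanism_exists:
  assumes "valid_params \<epsilon> n N p0" "admissible_outputs \<epsilon> n p0 a"
  shows "\<exists>q. structured_mechanism \<epsilon> n p0 a q"
proof -
  have "\<exists>f. continuous_on UNIV f \<and>
      (\<forall>j\<in>{- int n + 1..int n}. affine_on {node \<epsilon> n p0 a (j - 1)..node \<epsilon> n p0 a j} f) \<and>
      (\<forall>j\<in>{- int n..int n}. f (node \<epsilon> n p0 a j) = P \<epsilon> n p0 i j)" for i
    by (rule interpolation_exists) (use node_less[OF assms] in \<open>auto simp: indices_def\<close>)
  then obtain q where "\<And>i. continuous_on UNIV (q i) \<and>
      (\<forall>j\<in>{- int n + 1..int n}. affine_on {node \<epsilon> n p0 a (j - 1)..node \<epsilon> n p0 a j} (q i)) \<and>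
      (\<forall>j\<in>{- int n..int n}. q i (node \<epsilon> n p0 a j) = P \<epsilon> n p0 i j)"
    by metis
  then have "structured_mechanism \<epsilon> n p0 a q"
    unfolding structured_mechanism_def indices_def
    using continuous_on_subset[OF _ subset_UNIV] by blast
  then show ?thesis by blast
qed

lemma admissible_outputs_exist:
  assumes "valid_params \<epsilon> n N p0"
  shows "\<exists>a. admissible_outputs \<epsilon> n p0 a"
proof
  show "admissible_outputs \<epsilon> n p0 (\<lambda>i. real_of_int i / (real n * t_scale \<epsilon> n p0))"
    using t_scale_pos[OF assms] assms
    by (auto simp: admissible_outputs_def valid_params_def strict_mono_on_def divide_strict_right_mono)
qed

end

theory Submission
  imports Defs
begin

text \<open>On each linear piece \<open>q i\<close> takes values between its two node values, so it suffices that
  every row of \<open>P\<close> lies in an interval \<open>[m, e\<^sup>\<epsilon> m]\<close>. Row \<open>0\<close> has \<open>m = p\<^sub>0\<close>; for the other rows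
  \<open>m = p\<close> works, where the entry \<open>p\<^sup>*\<close> of the rows \<open>\<plusminus>1\<close> is controlled by
  \<open>2 p\<^sup>* = (e\<^sup>\<epsilon> + 1) p - (e\<^sup>\<epsilon> - 1) p\<^sub>0\<close> and \<open>0 \<le> p\<^sub>0 \<le> p\<close>.\<close>

lemma affine_on_between:
  assumes aff: "affine_on {A..B} f" and x: "x \<in> {A..B}"
    and A: "f A \<in> {m..M}" and B: "f B \<in> {m..M}"
  shows "f x \<in> {m..M}"
proof -
  obtain c d where cd: "\<And>y. y \<in> {A..B} \<Longrightarrow> f y = c * y + d"
    using aff unfolding affine_on_def by blast
  have AB: "A \<in> {A..B}" "B \<in> {A..B}" using x by auto
  \<comment> \<open>The sign of \<open>c\<close> decides whether \<open>f\<close> increases or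
    decreases; either way \<open>f x\<close> lies between the two end values.\<close>
  have "c * A \<le> c * x \<and> c * x \<le> c * B \<or> c * B \<le> c * x \<and> c * x \<le> c * A"
    using x by (cases "c \<ge> 0") (auto intro: mult_left_mono mult_left_mono_neg)
  then show ?thesis
    using A B cd[OF x] cd[OF AB(1)] cd[OF AB(2)] by auto
qed

text \<open>Induction on the right end: a point up to \<open>X u\<close> falls under the induction
  hypothesis, any other lies in the newly added piece.\<close>

lemma piecewise_affine_between:
  fixes X :: "int \<Rightarrow> real"
  assumes "l \<le> u" "\<And>j. j \<in> {l + 1..u} \<Longrightarrow> affine_on {X (j - 1)..X j} f"
    and "\<And>j. j \<in> {l..u} \<Longrightarrow> f (X j) \<in> {m..M}" and "x \<in> {X l..X u}"
  shows "f x \<in> {m..M}"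
  using assms
proof (induction u rule: int_ge_induct)
  case base
  then have "x = X l" by simp
  then show ?case using base.prems(2) by simp
next
  case (step u)
  show ?case
  proof (cases "x \<le> X u")
    case True
    show ?thesis by (rule step.IH) (use step.prems True in auto)
  next
    case False
    show ?thesis
    proof (rule affine_on_between[where f = f and x = x])
      show "affine_on {X u..X (u + 1)} f"
        using step.prems(1)[of "u + 1"] step.hyps by simp
      show "x \<in> {X u..X (u + 1)}" using step.prems(3) False by simp
      show "f (X u) \<in> {m..M}" "f (X (u + 1)) \<in> {m..M}"
        using step.prems(2)[of u] step.prems(2)[of "u + 1"] step.hyps by simp_all
    qed
  qed
qed

text \<open>Eliminates \<open>n\<close>: clearing the denominator of \<open>p_base\<close> gives 1 -
  p0 = (exp \<epsilon> + 2n - 1) p, hence 1 - 2(n - 1) p = (exp \<epsilon> + 1) p + p0.\<close>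

lemma two_p_star:
  assumes "valid_params \<epsilon> n N p0"
  shows "2 * p_star \<epsilon> n p0 = (exp \<epsilon> + 1) * p_base \<epsilon> n p0 - (exp \<epsilon> - 1) * p0"
proof -
  have "exp \<epsilon> + 2 * real n - 1 > 0"
    using assms exp_gt_zero[of \<epsilon>] unfolding valid_params_def by linarith
  then have "1 - p0 = (exp \<epsilon> + 2 * real n - 1) * p_base \<epsilon> n p0"
    by (simp add: p_base_def)
  then have "p0 = 1 - (exp \<epsilon> + 2 * real n - 1) * p_base \<epsilon> n p0" by linarith
  then have "(exp \<epsilon> + 1) * p_base \<epsilon> n p0 + p0 = 1 - 2 * (real n - 1) * p_base \<epsilon> n p0"
    by (simp add: algebra_simps)
  moreover have "2 * p_star \<epsilon> n p0 = 1 - 2 * (real n - 1) * p_base \<epsilon> n p0 - exp \<epsilon> * p0"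
    by (simp add: p_star_def)
  ultimately show ?thesis by (simp add: algebra_simps)
qed

text \<open>Twice the two gaps are (exp \<epsilon> - 1)(p - p0) and (exp \<epsilon> - 1)(p + p0),
  both nonnegative.\<close>

lemma p_star_bounds:
  assumes "valid_params \<epsilon> n N p0"
  shows "p_base \<epsilon> n p0 \<le> p_star \<epsilon> n p0" "p_star \<epsilon> n p0 \<le> exp \<epsilon> * p_base \<epsilon> n p0"
proof -
  let ?p = "p_base \<epsilon> n p0"
  have E: "exp \<epsilon> - 1 \<ge> 0" and p0: "0 \<le> p0" "p0 \<le> ?p"
    using assms by (auto simp: valid_params_def)
  have "(exp \<epsilon> - 1) * p0 \<le> (exp \<epsilon> - 1) * ?p" "0 \<le> (exp \<epsilon> - 1) * p0" "0 \<le> (exp \<epsilon> - 1) * ?p"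
    using E p0 by (auto intro!: mult_left_mono mult_nonneg_nonneg)
  then show "?p \<le> p_star \<epsilon> n p0" "p_star \<epsilon> n p0 \<le> exp \<epsilon> * ?p"
    using two_p_star[OF assms] by (simp_all add: algebra_simps)
qed

lemma P_row_bounds:
  assumes v: "valid_params \<epsilon> n N p0"
  defines "m \<equiv> \<lambda>i. if i = 0 then p0 else p_base \<epsilon> n p0"
  shows "P \<epsilon> n p0 i j \<in> {m i..exp \<epsilon> * m i}"
proof -
  have E: "exp \<epsilon> \<ge> 1" and p0: "0 \<le> p0"
    using v by (auto simp: valid_params_def)
  \<comment> \<open>An entry equal to one end of its interval must also respect the other
    end.\<close>
  have "p0 \<le> exp \<epsilon> * p0" "p_base \<epsilon> n p0 \<le> exp \<epsilon> * p_base \<epsilon> n p0"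
    using mult_right_mono[OF E p0] mult_right_mono[OF E less_imp_le[OF p_base_pos[OF v]]] by auto
  then show ?thesis
    using p_star_bounds[OF v] by (auto simp: P_def m_def)
qed

theorem theorem1:
  fixes \<epsilon> p0 :: real and n N :: nat
    and a :: "int \<Rightarrow> real" and q :: "int \<Rightarrow> real \<Rightarrow> real"
  assumes "\<epsilon> > 0" and "n \<ge> 1" and "N = 2 * n \<or> N = 2 * n + 1"
    and "0 \<le> p0" and "p0 \<le> p_base \<epsilon> n p0" and "N = 2 * n \<longrightarrow> p0 = 0"
    and "admissible_outputs \<epsilon> n p0 a"
    and "structured_mechanism \<epsilon> n p0 a q"
  shows "locally_dp \<epsilon> (output_indices n N) q"
proof -
  have v: "valid_params \<epsilon> n N p0"
    using assms by (simp add: valid_params_def)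
  have "q i x \<le> exp \<epsilon> * q i x'"
    if "i \<in> output_indices n N" and x: "x \<in> {-1..1}" and x': "x' \<in> {-1..1}" for i x x'
  proof -
    \<comment> \<open>\<open>m\<close> depends on \<open>i\<close> alone, so one interval serves
      both inputs. They are compared through \<open>exp \<epsilon> * m\<close> without division,
      since \<open>m = 0\<close> can occur in row 0.\<close>
    define m where "m = (if i = 0 then p0 else p_base \<epsilon> n p0)"
    have i: "i \<in> indices n"
      using that(1) by (auto simp: output_indices_def split: if_splits)
    have bounds: "q i y \<in> {m..exp \<epsilon> * m}" if "y \<in> {-1..1}" for y
    proof (rule piecewise_affine_between[where f = "q i" and X = "node \<epsilon> n p0 a"])
      show "- int n \<le> int n" by simp
      show "affine_on {node \<epsilon> n p0 a (j - 1)..node \<epsilon> n p0 a j} (q i)"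
        if "j \<in> {- int n + 1..int n}" for j
        using assms(8) i that unfolding structured_mechanism_def by blast
      show "q i (node \<epsilon> n p0 a j) \<in> {m..exp \<epsilon> * m}" if "j \<in> {- int n..int n}" for j
      proof -
        have "q i (node \<epsilon> n p0 a j) = P \<epsilon> n p0 i j"
          using assms(8) i that unfolding structured_mechanism_def indices_def by blast
        then show ?thesis using P_row_bounds[OF v, of i j] by (simp only: m_def)
      qed
      \<comment> \<open>The pieces cover the whole input range: as \<open>a (int n)\<close> is 1/t
        and \<open>a\<close> is odd, the extreme nodes are -1 and 1.\<close>
      show "y \<in> {node \<epsilon> n p0 a (- int n)..node \<epsilon> n p0 a (int n)}"
        using that node_ends[OF v assms(7)] by simp
    qed
    have "q i x \<le> exp \<epsilon> * m" using bounds[OF x] by simp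
    also have "\<dots> \<le> exp \<epsilon> * q i x'" using bounds[OF x'] by simp
    finally show ?thesis .
  qed
  then show ?thesis unfolding locally_dp_def by blast
qed

end
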